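(* Let $a\ge b\ge 1$ be integers and let $\beta>1$ be the positive root of $\beta^2=a\beta+b$ (a quadratic Pisot number), with Galois conjugate $\beta'=a-\beta=-b/\beta$. Then \[ \gamma(\beta)=\begin{cases} 0 & \text{if } \sup_{j\in\mathbb Z} P_{\mathbf h(j-\beta)}(\beta')>\beta \text{ or } \inf_{j\in\mathbb Z} P_{\mathbf h(j)}(\beta')<-1,\\[0.5ex] \beta-a & \text{if } \sup_{j\in\mathbb Z} P_{\mathbf h(j-\beta)}(\beta')\in(2\beta-a-1,\beta] \text{ and } \inf_{j\in\mathbb Z} P_{\mathbf h(j)}(\beta')\ge \beta-a-1,\\[0.5ex] 1+\inf_{j\in\mathbb Z} P_{\mathbf h(j)}(\beta') & \text{otherwise.} \end{cases} \]
   Context: For a real $\beta>1$, the $\beta$-transformation is $T:[0,1)\to[0,1)$, $T(x)=\beta x-\lfloor \beta x\rfloor$, and the (Rényi) $\beta$-expansion of $x\in[0,1)$ is the infinite digit string $x_1x_2x_3\cdots$ with $x_j=\lfloor \beta T^{j-1}x\rfloor$. It is purely periodic if there is $p\ge1$ with $x_{k+p}=x_k$ for all $k\ge1$. For a Pisot number $\beta$ with norm $N(\beta)$, set $b=|N(\beta)|$ and define $\gamma(\beta)=\inf\big(\{p/q\in\mathbb Q\cap[0,1): \gcd(q,b)=1,\ p/q \text{ does not have a purely periodic }\beta\text{-expansion}\}\cup\{1\}\big)$. For an algebraic integer $\beta$, the $\beta$-adic expansion of $x\in\mathbb Z[\beta]$ is the unique infinite word $\mathbf h(x)=u_0u_1u_2\cdots$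 with $u_n\in\{0,1,\dots,|N(\beta)|-1\}$ such that $x-\sum_{i=0}^{n-1}u_i\beta^i\in\beta^n\mathbb Z[\beta]$ for all $n\in\mathbb N$. For an infinite word $\mathbf u=u_0u_1\cdots$ of integers, $P_{\mathbf u}(X)=\sum_{n\ge0}u_nX^n$ (for a finite word $w=w_0\cdots w_{k-1}$, $P_w(X)=\sum_{i=0}^{k-1}w_iX^i$). Here $|N(\beta)|=b$ and $-1<\beta'<0$. *)

theory Defs
  imports Complex_Main "HOL-Computational_Algebra.Polynomial"
begin

definition beta_T :: "real \<Rightarrow> real \<Rightarrow> real" where
  "beta_T \<beta> x = \<beta> * x - of_int \<lfloor>\<beta> * x\<rfloor>"

definition beta_digit :: "real \<Rightarrow> real \<Rightarrow> nat \<Rightarrow> int" where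
  "beta_digit \<beta> x j = \<lfloor>\<beta> * (beta_T \<beta> ^^ (j - 1)) x\<rfloor>"

definition purely_periodic_beta :: "real \<Rightarrow> real \<Rightarrow> bool" where
  "purely_periodic_beta \<beta> x \<longleftrightarrow>
     (\<exists>p\<ge>1. \<forall>k\<ge>1. beta_digit \<beta> x (k + p) = beta_digit \<beta> x k)"

text \<open>gamma(beta), where the parameter N stands for |N(beta)|.\<close>
definition gamma_beta :: "real \<Rightarrow> int \<Rightarrow> real" where
  "gamma_beta \<beta> N = Inf ({x. (\<exists>p q::int. q > 0 \<and> gcd q N = 1 \<and> x = of_int p / of_int q)
                              \<and> 0 \<le> x \<and> x < 1 \<and> \<not> purely_periodic_beta \<beta> x} \<union> {1})"

definition Zbeta :: "real \<Rightarrow> real set" where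
  "Zbeta \<beta> = {x. \<exists>p::int poly. x = poly (map_poly of_int p) \<beta>}"

text \<open>The beta-adic expansion h(x) with digits in {0,...,N-1}, N = |N(beta)|.\<close>
definition beta_adic :: "real \<Rightarrow> int \<Rightarrow> real \<Rightarrow> nat \<Rightarrow> int" where
  "beta_adic \<beta> N x = (THE u. (\<forall>n. 0 \<le> u n \<and> u n < N) \<and>
      (\<forall>n. \<exists>z\<in>Zbeta \<beta>. x - (\<Sum>i<n. of_int (u i) * \<beta> ^ i) = \<beta> ^ n * z))"

definition Pword :: "(nat \<Rightarrow> int) \<Rightarrow> real \<Rightarrow> real" where
  "Pword u X = (\<Sum>n. of_int (u n) * X ^ n)"

end

(* Write h(v) for the beta-adic word of v. For x = p/q with gcd(q, b) = 1, the T-preimages of a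
   point w of (1/q)Z[beta] in [0,1) are y_d = (w+d)/beta with d = -w mod beta and 0 <= d < a, or
   d = a if w < beta - a. Galois conjugation expands preimages, so x is purely periodic iff some
   backward orbit of x stays bounded under conjugation.
   Put tau(v) = v' - P_h(v)(beta'), so that tau(v) = beta' tau((v - digit)/beta), and let sigma(w)
   be the representative of w - beta modulo 1 in [-1,0). For fixed w, the points y_d - 1 chain up:
   sigma(y_(d+b)) = y_d - 1, and the ends of the chain are the beta-adic shifts of w - 1 and of
   sigma(w). Hence the purely periodic points are exactly those with
   tau(w - 1) <= 0 <= tau(sigma(w)): some preimage stays in this region by a discrete intermediate
   value argument, and monotonicity of tau makes T contract towards it.
   For rational x this condition reads P_h(x-1)(beta') >= x - 1 and
   P_h(x+a-c-beta)(beta') <= beta - c + x, with c = 0 if x < beta - a and c = 1 otherwise.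
   Approximating rationals beta-adically by integers yields the three cases. *)
theory Submission
  imports Defs "HOL-Number_Theory.Cong"
begin

subsection \<open>Quadratic Pisot bases\<close>

locale quad_pisot =
  fixes a b :: int and \<beta> :: real
  assumes ab: "b \<le> a" and b1: "1 \<le> b" and beta1: "1 < \<beta>"
    and quad: "\<beta>\<^sup>2 = of_int a * \<beta> + of_int b"
begin

abbreviation \<beta>c :: real where "\<beta>c \<equiv> of_int a - \<beta>"

text \<open>The norm relation \<beta> \<beta>' = -b. It identifies \<beta> - a, where
  \<open>high\<close> changes branch, with b / \<beta>.\<close>

lemma beta_mult_frac: "\<beta> * (\<beta> - of_int a) = of_int b"
  using quad by (simp add: algebra_simps power2_eq_square)

lemma beta_gt: "of_int a < \<beta>"
proof (rule ccontr)
  assume "\<not> of_int a < \<beta>"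
  then have "\<beta> * (\<beta> - of_int a) \<le> 0" using beta1 by (simp add: mult_le_0_iff)
  then show False using beta_mult_frac b1 by simp
qed

lemma beta_lt: "\<beta> < of_int a + 1"
proof (rule ccontr)
  assume "\<not> ?thesis"
  then have "\<beta> * 1 \<le> \<beta> * (\<beta> - of_int a)" using beta1 by (intro mult_left_mono) auto
  then have "\<beta> \<le> of_int b" using beta_mult_frac by simp
  then show False using beta_gt ab by linarith
qed

lemma conj_bounds: "-1 < \<beta>c" "\<beta>c < 0"
  using beta_gt beta_lt by auto

lemma conj_quad: "\<beta>c * \<beta>c = of_int a * \<beta>c + of_int b"
  using beta_mult_frac by (simp add: algebra_simps)

text \<open>A least \<open>s > 0\<close> with \<open>s \<beta>\<close> integral would be improved by \<open>s (\<beta> - a)\<close>.\<close>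
lemma beta_irrational_aux: "0 < s \<Longrightarrow> of_nat s * \<beta> \<noteq> of_int r"
proof (induction s arbitrary: r rule: less_induct)
  case (less s)
  show ?case
  proof
    assume eq: "real s * \<beta> = of_int r"
    define t where "t = r - int s * a"
    have t: "of_int t = real s * (\<beta> - of_int a)"
      using eq by (simp add: t_def algebra_simps)
    have "0 < real_of_int t" using t less.prems beta_gt by simp
    moreover have "real_of_int t < real s * 1"
      unfolding t using less.prems beta_lt by (intro mult_strict_left_mono) auto
    ultimately have "0 < nat t" "nat t < s" by linarith+
    moreover have "real (nat t) = real s * (\<beta> - of_int a)"
      using t \<open>0 < nat t\<close> by simp
    then have "real (nat t) * \<beta> = of_int (int s * b)"
      using beta_mult_frac by (simp add: mult.assoc mult.commute)
    ultimately show False using less.IH by blast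
  qed
qed

lemma beta_irrational:
  assumes "of_int r + of_int s * \<beta> = 0"
  shows "r = 0 \<and> s = 0"
proof -
  have "s = 0"
  proof (rule ccontr)
    assume "s \<noteq> 0"
    then have "0 < nat \<bar>s\<bar>" by simp
    moreover have "real (nat \<bar>s\<bar>) * \<beta> = of_int (- sgn s * r)"
      using assms by (cases "s > 0") (auto simp: sgn_if)
    ultimately show False using beta_irrational_aux by blast
  qed
  then show ?thesis using assms by simp
qed

text \<open>Horner's scheme never leaves Z + Z \<beta>, because \<beta>^2 = a \<beta> + b.\<close>

lemma Zbeta_eq: "Zbeta \<beta> = {of_int m + of_int n * \<beta> | m n. True}"
proof (intro equalityI subsetI)
  fix x assume "x \<in> Zbeta \<beta>"
  then obtain p :: "int poly" where x: "x = poly (map_poly of_int p) \<beta>"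
    by (auto simp: Zbeta_def)
  have "\<exists>m n. poly (map_poly of_int p) \<beta> = of_int m + of_int n * \<beta>"
  proof (induction p)
    case 0
    show ?case by (rule exI[of _ 0], rule exI[of _ 0]) simp
  next
    case (pCons c p)
    then obtain m n where "poly (map_poly of_int p) \<beta> = of_int m + of_int n * \<beta>" by blast
    then have "poly (map_poly of_int (pCons c p)) \<beta>
        = of_int c + of_int m * \<beta> + of_int n * \<beta>\<^sup>2"
      using pCons.hyps by (simp add: map_poly_pCons algebra_simps power2_eq_square)
    also have "\<dots> = of_int (c + n * b) + of_int (m + n * a) * \<beta>"
      unfolding quad by (simp add: algebra_simps)
    finally have "poly (map_poly of_int (pCons c p)) \<beta>
        = of_int (c + n * b) + of_int (m + n * a) * \<beta>" .
    then show ?case by blast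
  qed
  then show "x \<in> {of_int m + of_int n * \<beta> | m n. True}" using x by blast
next
  fix x assume "x \<in> {of_int m + of_int n * \<beta> | m n. True}"
  then obtain m n where "x = of_int m + of_int n * \<beta>" by blast
  then have "x = poly (map_poly of_int [:m, n:]) \<beta>"
    by (simp add: map_poly_pCons)
  then show "x \<in> Zbeta \<beta>" unfolding Zbeta_def by blast
qed

end

subsection \<open>The lattice of fractions with denominator \<open>q\<close>\<close>

text \<open>A pair \<open>(r, s)\<close> stands for \<open>(r + s \<beta>) / q\<close>.\<close>
locale quad_frac = quad_pisot +
  fixes q qi :: int
  assumes q_pos: "0 < q" and qi: "[q * qi = 1] (mod b)"
begin

definition val :: "int \<times> int \<Rightarrow> real" where
  "val v = (of_int (fst v) + of_int (snd v) * \<beta>) / of_int q"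

definition cnj :: "int \<times> int \<Rightarrow> real" where
  "cnj v = (of_int (fst v) + of_int (snd v) * \<beta>c) / of_int q"

text \<open>The residue of v modulo \<beta>: \<beta> divides r + s \<beta> in Z[\<beta>] iff b
  divides r, and \<open>qi\<close> inverts q modulo b.\<close>

definition digit :: "int \<times> int \<Rightarrow> int" where
  "digit v = (fst v * qi) mod b"

text \<open>This is (v - \<open>digit v\<close>) / \<beta>: as b / \<beta> = \<beta> - a, a constant
  coordinate b k turns into k \<beta> - a k.\<close>

definition shift :: "int \<times> int \<Rightarrow> int \<times> int" where
  "shift v = (let k = (fst v - q * digit v) div b in (snd v - a * k, k))"

definition word :: "int \<times> int \<Rightarrow> nat \<Rightarrow> int" where
  "word v n = digit ((shift ^^ n) v)"

definition Pval :: "int \<times> int \<Rightarrow> real" where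
  "Pval v = Pword (word v) \<beta>c"

definition \<tau> :: "int \<times> int \<Rightarrow> real" where
  "\<tau> v = cnj v - Pval v"

text \<open>The sum of the geometric series b |\<beta>'|^n. It does not depend on q and so serves
  all denominators at once.\<close>

definition Pbound :: real where "Pbound = of_int b / (1 - \<bar>\<beta>c\<bar>)"

section \<open>Division with remainder by \<beta>\<close>

lemma coprime_q_b: "coprime q b"
  using qi by (meson cong_imp_coprime cong_sym coprime_1_left coprime_mult_left_iff)

lemma digit_bounds: "0 \<le> digit v" "digit v < b"
  using b1 by (auto simp: digit_def)

lemma cong_digit: "[q * digit v = fst v] (mod b)"
proof -
  have "[q * digit v = q * (fst v * qi)] (mod b)"
    by (intro cong_mult cong_refl) (simp add: digit_def cong_def)
  moreover have "[(q * qi) * fst v = 1 * fst v] (mod b)" by (intro cong_mult qi cong_refl)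
  ultimately show ?thesis by (metis cong_trans mult.assoc mult.commute mult_1)
qed

text \<open>As q is a unit modulo b, a decomposition with remainder in [0, b) is unique.\<close>

lemma digit_shift_eqI:
  assumes "0 \<le> e" "e < b" "fst v = q * e + b * k"
  shows "digit v = e" "shift v = (snd v - a * k, k)"
proof -
  have "[q * digit v = q * e] (mod b)"
    using cong_digit[of v] assms(3) by (simp add: cong_def)
  then have "[digit v = e] (mod b)"
    using coprime_q_b by (simp add: cong_mult_lcancel)
  then show digit: "digit v = e"
    using assms digit_bounds[of v] by (simp add: cong_def)
  show "shift v = (snd v - a * k, k)"
    using b1 assms(3) by (simp add: shift_def digit Let_def)
qed

lemma fst_decomp:
  obtains k where "fst v = q * digit v + b * k" "shift v = (snd v - a * k, k)"
proof -
  have "b dvd fst v - q * digit v" using cong_digit[of v] by (meson cong_iff_dvd_diff cong_sym)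
  then obtain k where "fst v - q * digit v = b * k" by blast
  then have k: "fst v = q * digit v + b * k" by simp
  then show ?thesis using that digit_shift_eqI(2)[OF digit_bounds k] by blast
qed

lemma val_shift: "val v = of_int (digit v) + \<beta> * val (shift v)"
proof -
  obtain k where k: "fst v = q * digit v + b * k" "shift v = (snd v - a * k, k)"
    using fst_decomp .
  have "of_int k * (\<beta> * \<beta>) = of_int k * (of_int a * \<beta> + of_int b)"
    using quad by (simp add: power2_eq_square)
  then show ?thesis using q_pos k by (simp add: val_def field_simps)
qed

lemma cnj_shift: "cnj v = of_int (digit v) + \<beta>c * cnj (shift v)"
proof -
  obtain k where k: "fst v = q * digit v + b * k" "shift v = (snd v - a * k, k)"
    using fst_decomp .
  have "q * cnj v = of_int (q * digit v + b * k) + of_int (snd v) * \<beta>c"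
    using q_pos by (simp add: cnj_def k(1))
  also have "\<dots> = q * digit v + of_int (snd v) * \<beta>c + of_int k * (\<beta>c * \<beta>c - of_int a * \<beta>c)"
    unfolding conj_quad by (simp add: algebra_simps)
  also have "\<dots> = q * digit v + \<beta>c * (of_int (snd v - a * k) + of_int k * \<beta>c)"
    by (simp add: algebra_simps)
  also have "\<dots> = q * (of_int (digit v) + \<beta>c * cnj (shift v))"
    using q_pos by (simp add: cnj_def k(2) field_simps)
  finally show ?thesis using q_pos by simp
qed

section \<open>Words and their power series at the conjugate\<close>

lemma word_0: "word v 0 = digit v"
  by (simp add: word_def)

lemma word_Suc: "word v (Suc n) = word (shift v) n"
  by (simp add: word_def funpow_Suc_right del: funpow.simps)

lemma norm_word_le: "norm (of_int (word v n) * \<beta>c ^ n) \<le> of_int b * \<bar>\<beta>c\<bar> ^ n"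
proof -
  have "\<bar>real_of_int (word v n)\<bar> \<le> of_int b"
    using digit_bounds[of "(shift ^^ n) v"] by (simp add: word_def)
  then show ?thesis
    by (simp add: abs_mult power_abs mult_right_mono)
qed

lemma summable_bound: "summable (\<lambda>n. of_int b * \<bar>\<beta>c\<bar> ^ n)"
  using conj_bounds by (intro summable_mult summable_geometric) auto

lemma summable_word: "summable (\<lambda>n. of_int (word v n) * \<beta>c ^ n)"
  by (rule summable_comparison_test[OF _ summable_bound]) (use norm_word_le in blast)

lemma Pval_bound: "\<bar>Pval v\<bar> \<le> Pbound"
proof -
  have "norm (\<Sum>n. of_int (word v n) * \<beta>c ^ n) \<le> (\<Sum>n. of_int b * \<bar>\<beta>c\<bar> ^ n)"
    by (intro norm_suminf_le norm_word_le summable_bound)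
  also have "\<dots> = Pbound"
    using conj_bounds unfolding Pbound_def
    by (subst suminf_mult) (auto simp: suminf_geometric intro!: summable_geometric)
  finally show ?thesis by (simp add: Pval_def Pword_def)
qed

lemma Pval_shift: "Pval v = of_int (digit v) + \<beta>c * Pval (shift v)"
proof -
  have "Pval v = of_int (word v 0) * \<beta>c ^ 0 + (\<Sum>n. of_int (word v (Suc n)) * \<beta>c ^ Suc n)"
    using suminf_split_head[OF summable_word, of v] by (simp add: Pval_def Pword_def)
  also have "(\<Sum>n. of_int (word v (Suc n)) * \<beta>c ^ Suc n)
      = \<beta>c * (\<Sum>n. of_int (word (shift v) n) * \<beta>c ^ n)"
    by (subst suminf_mult[symmetric, OF summable_word]) (simp add: word_Suc mult.left_commute)
  finally show ?thesis by (simp add: Pval_def Pword_def word_0)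
qed

lemma Pval_split: "Pval v = (\<Sum>i<n. of_int (word v i) * \<beta>c ^ i) + \<beta>c ^ n * Pval ((shift ^^ n) v)"
proof (induction n)
  case (Suc n)
  then show ?case using Pval_shift[of "(shift ^^ n) v"]
    by (simp add: word_def algebra_simps)
qed simp

lemma val_split: "val v = (\<Sum>i<n. of_int (word v i) * \<beta> ^ i) + \<beta> ^ n * val ((shift ^^ n) v)"
proof (induction n)
  case (Suc n)
  then show ?case using val_shift[of "(shift ^^ n) v"]
    by (simp add: word_def algebra_simps)
qed simp

section \<open>Monotonicity of \<tau> modulo Z[\<beta>]\<close>

lemma tau_shift: "\<tau> v = \<beta>c * \<tau> (shift v)"
  using Pval_shift[of v] cnj_shift[of v] by (simp add: \<tau>_def algebra_simps)

text \<open>Subtracting the digit leaves a number in [-b, 0), and b \<le> a < \<beta>.\<close>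

lemma val_shift_range:
  assumes "-1 \<le> val v" "val v < 0"
  shows "-1 \<le> val (shift v)" "val (shift v) < 0"
proof -
  have d: "0 \<le> real_of_int (digit v)" "real_of_int (digit v) \<le> b - 1"
    using digit_bounds[of v] by linarith+
  have "\<beta> * (-1) \<le> \<beta> * val (shift v)" using val_shift[of v] d assms beta_gt ab by linarith
  then show "-1 \<le> val (shift v)" using beta1 by (simp only: mult_le_cancel_left_pos)
  have "\<beta> * val (shift v) < 0" using val_shift[of v] d assms by linarith
  then show "val (shift v) < 0" using beta1 by (simp add: mult_less_0_iff)
qed

text \<open>Congruence modulo Z[\<beta>].\<close>

definition same_class :: "int \<times> int \<Rightarrow> int \<times> int \<Rightarrow> bool" where
  "same_class v w \<longleftrightarrow> q dvd fst w - fst v \<and> q dvd snd w - snd v"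

text \<open>While \<open>val\<close> stays in a bounded interval, \<open>snd\<close> thus orders
  points by decreasing conjugate, up to a bounded error.\<close>

lemma val_cnj: "val v - cnj v = of_int (snd v) * (\<beta> - \<beta>c) / of_int q"
  using q_pos by (simp add: val_def cnj_def field_simps)

text \<open>Write w - v = m + n \<beta> with n \<ge> 0; the difference of the values is below 1 in
  modulus. If n = 0, then m = 0. Otherwise m < 1 - b, and -m outweighs any difference of two
  digits.\<close>

lemma shift_antimono:
  assumes "-1 \<le> val v" "val v < 0" "-1 \<le> val w" "val w < 0"
    "same_class v w" "snd v \<le> snd w"
  shows "same_class (shift w) (shift v)" "snd (shift w) \<le> snd (shift v)"
proof -
  obtain m n where m: "fst w = fst v + q * m" and n: "snd w = snd v + q * n"
    using assms(5) by (force simp: same_class_def dvd_def algebra_simps)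
  obtain k where k: "fst v = q * digit v + b * k" "shift v = (snd v - a * k, k)"
    using fst_decomp .
  obtain l where l: "fst w = q * digit w + b * l" "shift w = (snd w - a * l, l)"
    using fst_decomp .
  have eq: "b * (k - l) = q * (digit w - digit v - m)"
    using k(1) l(1) m by (simp add: algebra_simps)
  then have "b dvd digit w - digit v - m"
    using coprime_q_b by (metis coprime_commute coprime_dvd_mult_right_iff dvd_triv_left)
  then obtain j where j: "digit w - digit v - m = b * j" by blast
  then have "b * (k - l) = b * (q * j)" using eq j by (metis mult.left_commute)
  then have kl: "k = l + q * j" using b1 by simp
  have "0 \<le> n" using assms(6) q_pos n by (simp add: zero_le_mult_iff)
  have diff: "val w - val v = of_int m + of_int n * \<beta>"
    using q_pos by (simp add: val_def m n field_simps)
  have "0 \<le> j"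
  proof (cases "n = 0")
    case True
    then have "\<bar>real_of_int m\<bar> < 1" using diff assms(1-4) by auto
    then have "m = 0" by linarith
    then have "digit v = digit w" using m by (simp add: digit_def)
    then show ?thesis using j \<open>m = 0\<close> b1 by simp
  next
    case False
    then have "1 \<le> n" using \<open>0 \<le> n\<close> by simp
    then have "1 * \<beta> \<le> of_int n * \<beta>" using beta1 by (intro mult_right_mono) auto
    then have "real_of_int m < 1 - b" using diff assms(1-4) beta_gt ab by linarith
    then have "m < 1 - b" by linarith
    then have "0 < b * j" using j digit_bounds[of v] digit_bounds[of w] by linarith
    then show ?thesis using b1 by (simp add: zero_less_mult_iff)
  qed
  then show "snd (shift w) \<le> snd (shift v)" using kl k(2) l(2) q_pos by simp
  have "fst (shift v) - fst (shift w) = q * (- n - a * j)"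
    using k(2) l(2) kl n by (simp add: algebra_simps)
  then show "same_class (shift w) (shift v)"
    unfolding same_class_def using k(2) l(2) kl by simp
qed

text \<open>Since \<open>\<tau> v = \<beta>c * \<tau> (shift v)\<close> with \<open>-1 < \<beta>c < 0\<close> and \<open>shift\<close> reverses the order given by
  the second components, any a priori lower bound for the differences improves by a factor
  \<open>\<bar>\<beta>c\<bar>\<close>.\<close>
lemma tau_antimono:
  assumes "-1 \<le> val v" "val v < 0" "-1 \<le> val w" "val w < 0"
    "same_class v w" "snd v \<le> snd w"
  shows "\<tau> w \<le> \<tau> v"
proof -
  \<comment> \<open>The interval [-1, 0) contributes 1 and each of the two values of
    \<open>Pval\<close> contributes \<open>Pbound\<close>.\<close>
  define C where "C = 1 + 2 * Pbound"
  have bound: "- (C * \<bar>\<beta>c\<bar> ^ n) \<le> \<tau> v - \<tau> w"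
    if "-1 \<le> val v" "val v < 0" "-1 \<le> val w" "val w < 0"
      "same_class v w" "snd v \<le> snd w" for n v w
    using that
  proof (induction n arbitrary: v w)
    case 0
    have "of_int (snd v) * (\<beta> - \<beta>c) / of_int q \<le> of_int (snd w) * (\<beta> - \<beta>c) / of_int q"
      using 0 q_pos conj_bounds beta1 by (intro divide_right_mono mult_right_mono) auto
    then have "-1 \<le> cnj v - cnj w" using val_cnj[of v] val_cnj[of w] 0 by linarith
    then show ?case using Pval_bound[of v] Pval_bound[of w] by (simp add: \<tau>_def C_def)
  next
    case (Suc n)
    \<comment> \<open>The induction hypothesis is applied with the roles exchanged; the negative
      factor \<open>\<beta>c\<close> exchanges them back.\<close>
    have "- (C * \<bar>\<beta>c\<bar> ^ n) \<le> \<tau> (shift w) - \<tau> (shift v)"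
      using Suc.prems shift_antimono val_shift_range by (intro Suc.IH) auto
    then have "\<bar>\<beta>c\<bar> * (- (C * \<bar>\<beta>c\<bar> ^ n)) \<le> \<bar>\<beta>c\<bar> * (\<tau> (shift w) - \<tau> (shift v))"
      by (intro mult_left_mono) auto
    also have "\<dots> = \<tau> v - \<tau> w"
      using conj_bounds tau_shift[of v] tau_shift[of w] by (simp add: algebra_simps)
    finally show ?case by (simp add: algebra_simps)
  qed
  have "(\<lambda>n. \<bar>\<beta>c\<bar> ^ n) \<longlonglongrightarrow> 0"
    using conj_bounds by (intro LIMSEQ_realpow_zero) auto
  then have "(\<lambda>n. - (C * \<bar>\<beta>c\<bar> ^ n)) \<longlonglongrightarrow> - (C * 0)"
    by (intro tendsto_minus tendsto_mult_left)
  then have "- (C * 0) \<le> \<tau> v - \<tau> w"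
    using bound[OF assms] by (intro LIMSEQ_le_const2) auto
  then show ?thesis by simp
qed

subsection \<open>The natural extension domain\<close>

text \<open>The \<beta>-transformation on coordinates, where conjugates remain accessible:
  multiplication by \<beta> sends (r, s) to (b s, r + a s).\<close>

definition beta_step :: "int \<times> int \<Rightarrow> int \<times> int" where
  "beta_step y = (b * snd y - q * \<lfloor>\<beta> * val y\<rfloor>, fst y + a * snd y)"

text \<open>\<open>low y\<close> stands for \<open>y - 1\<close> and \<open>high y\<close> for the representative of \<open>y - \<beta>\<close> modulo 1 in
  \<open>[-1, 0)\<close>; \<open>y\<close> belongs to the natural extension domain iff \<open>\<tau> (low y) \<le> 0 \<le> \<tau> (high y)\<close>.\<close>
definition low :: "int \<times> int \<Rightarrow> int \<times> int" where
  "low y = (fst y - q, snd y)"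

definition high :: "int \<times> int \<Rightarrow> int \<times> int" where
  "high y = (fst y + q * a - (if val y < \<beta> - of_int a then 0 else q), snd y - q)"

lemma val_low: "val (low y) = val y - 1"
  using q_pos by (simp add: val_def low_def field_simps)

lemma val_high: "val (high y) = val y - \<beta> + of_int a - (if val y < \<beta> - of_int a then 0 else 1)"
  using q_pos by (simp add: val_def high_def field_simps)

lemma cnj_low: "cnj (low y) = cnj y - 1"
  using q_pos by (simp add: cnj_def low_def field_simps)

lemma cnj_high: "cnj (high y) = cnj y + \<beta> - (if val y < \<beta> - of_int a then 0 else 1)"
  using q_pos by (simp add: cnj_def high_def field_simps)

section \<open>The effect of the \<beta>-transformation on \<tau>\<close>

lemma val_beta_step: "val (beta_step y) = beta_T \<beta> (val y)"
proof -
  have "of_int (snd y) * (\<beta> * \<beta>) = of_int (snd y) * (of_int a * \<beta> + of_int b)"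
    using quad by (simp add: power2_eq_square)
  moreover have "of_int q * val y = of_int (fst y) + of_int (snd y) * \<beta>"
    using q_pos by (simp add: val_def)
  then have "\<beta> * (of_int q * val y) = \<beta> * (of_int (fst y) + of_int (snd y) * \<beta>)" by simp
  moreover have "of_int q * val (beta_step y) = of_int (b * snd y - q * \<lfloor>\<beta> * val y\<rfloor>)
      + of_int (fst y + a * snd y) * \<beta>"
    using q_pos by (simp add: beta_step_def val_def[of "(_,_)"])
  ultimately have "of_int q * val (beta_step y) = of_int q * (\<beta> * val y - of_int \<lfloor>\<beta> * val y\<rfloor>)"
    by (simp add: algebra_simps)
  then show ?thesis using q_pos by (simp add: beta_T_def)
qed

lemma val_beta_step_range: "0 \<le> val (beta_step y)" "val (beta_step y) < 1"
  unfolding val_beta_step beta_T_def by linarith+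

lemma val_low_range:
  assumes "0 \<le> val y" "val y < 1"
  shows "-1 \<le> val (low y)" "val (low y) < 0"
  using assms by (auto simp: val_low)

lemma val_high_range:
  assumes "0 \<le> val y" "val y < 1"
  shows "-1 \<le> val (high y)" "val (high y) < 0"
  using assms beta_gt beta_lt by (auto simp: val_high)

text \<open>The shift of \<open>low (beta_step y)\<close> is y - j (\<beta> - a), where b j = d + 1
  + digit is positive, so j \<ge> 1. It is congruent to \<open>high y\<close> and has no larger
  second coordinate, so \<open>tau_antimono\<close> compares the two.\<close>

lemma tau_low_beta_step:
  assumes y: "0 \<le> val y" "val y < 1"
  shows "\<tau> (low (beta_step y)) \<le> \<beta>c * \<tau> (high y)"
proof -
  define d where "d = \<lfloor>\<beta> * val y\<rfloor>"
  define w where "w = low (beta_step y)"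
  have "0 \<le> d" using y beta1 by (simp add: d_def)
  obtain k where k: "fst w = q * digit w + b * k" "shift w = (snd w - a * k, k)"
    using fst_decomp .
  have eq: "q * (d + 1 + digit w) = b * (snd y - k)"
    using k(1) by (simp add: w_def low_def beta_step_def d_def algebra_simps)
  then have "b dvd d + 1 + digit w"
    using coprime_q_b by (metis coprime_commute coprime_dvd_mult_right_iff dvd_triv_left)
  then obtain j where j: "d + 1 + digit w = b * j" by blast
  have "b * (snd y - k) = b * (q * j)" using eq j by (metis mult.left_commute)
  then have kj: "k = snd y - q * j" using b1 by simp
  have "0 < b * j" using j \<open>0 \<le> d\<close> digit_bounds[of w] by linarith
  then have "1 \<le> j" using b1 by (simp add: zero_less_mult_iff)
  have nxw: "shift w = (fst y + a * q * j, snd y - q * j)"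
    using k(2) kj by (simp add: w_def low_def beta_step_def algebra_simps)
  have "\<tau> (high y) \<le> \<tau> (shift w)"
  proof (rule tau_antimono)
    show "-1 \<le> val (shift w)" "val (shift w) < 0"
      using val_shift_range val_low_range[OF val_beta_step_range] by (auto simp: w_def)
    show "-1 \<le> val (high y)" "val (high y) < 0" using val_high_range y by auto
    show "same_class (shift w) (high y)"
      unfolding nxw same_class_def high_def by (auto simp: algebra_simps intro: dvd_add dvd_diff)
    show "snd (shift w) \<le> snd (high y)"
      using \<open>1 \<le> j\<close> q_pos by (simp add: nxw high_def)
  qed
  then have "\<beta>c * \<tau> (shift w) \<le> \<beta>c * \<tau> (high y)"
    using conj_bounds by (intro mult_left_mono_neg) auto
  then show ?thesis using tau_shift[of w] by (simp add: w_def)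
qed

text \<open>The shift of \<open>high (beta_step y)\<close> is y - 1 + j (\<beta> - a), where b j = a
  - c - d - digit exceeds -b, so j \<ge> 0. Now \<open>tau_antimono\<close> compares it with
  \<open>low y\<close>.\<close>

lemma tau_high_beta_step:
  assumes y: "0 \<le> val y" "val y < 1"
  shows "\<beta>c * \<tau> (low y) \<le> \<tau> (high (beta_step y))"
proof -
  define d where "d = \<lfloor>\<beta> * val y\<rfloor>"
  define c :: int where "c = (if val (beta_step y) < \<beta> - of_int a then 0 else 1)"
  define w where "w = high (beta_step y)"
  have Tv: "val (beta_step y) = \<beta> * val y - of_int d" by (simp add: val_beta_step beta_T_def d_def)
  have lt: "\<beta> * val y < \<beta>" using y beta1 by simp
  have "real_of_int d \<le> \<beta> * val y" by (simp add: d_def)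
  then have "real_of_int d < a + 1" using lt beta_lt by linarith
  then have "d \<le> a" by linarith
  \<comment> \<open>The digit a leaves \<beta> y - a < \<beta> - a, which forces c = 0.\<close>
  have dc: "d \<le> a - c"
  proof (cases "d = a")
    case True
    then show ?thesis using Tv lt by (simp add: c_def)
  next
    case False
    then show ?thesis using \<open>d \<le> a\<close> by (simp add: c_def)
  qed
  obtain k where k: "fst w = q * digit w + b * k" "shift w = (snd w - a * k, k)"
    using fst_decomp .
  have eq: "q * (a - c - d - digit w) = b * (k - snd y)"
    using k(1) by (auto simp: w_def high_def beta_step_def d_def[symmetric] c_def algebra_simps)
  then have "b dvd a - c - d - digit w"
    using coprime_q_b by (metis coprime_commute coprime_dvd_mult_right_iff dvd_triv_left)
  then obtain j where j: "a - c - d - digit w = b * j" by blast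
  have "b * (k - snd y) = b * (q * j)" using eq j by (metis mult.left_commute)
  then have kj: "k = snd y + q * j" using b1 by simp
  have "b * (-1) < b * j" using j dc digit_bounds[of w] by linarith
  then have "0 \<le> j" using b1 by (simp only: mult_less_cancel_left_pos)
  have nxw: "shift w = (fst y - q - a * q * j, snd y + q * j)"
    using k(2) kj by (simp add: w_def high_def beta_step_def algebra_simps)
  have "\<tau> (shift w) \<le> \<tau> (low y)"
  proof (rule tau_antimono)
    show "-1 \<le> val (shift w)" "val (shift w) < 0"
      using val_shift_range val_high_range[OF val_beta_step_range] by (auto simp: w_def)
    show "-1 \<le> val (low y)" "val (low y) < 0" using val_low_range y by auto
    show "same_class (low y) (shift w)"
      unfolding nxw same_class_def low_def by (auto simp: algebra_simps)
    show "snd (low y) \<le> snd (shift w)"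
      using \<open>0 \<le> j\<close> q_pos by (simp add: nxw low_def)
  qed
  then have "\<beta>c * \<tau> (low y) \<le> \<beta>c * \<tau> (shift w)"
    using conj_bounds by (intro mult_left_mono_neg) auto
  then show ?thesis using tau_shift[of w] by (simp add: w_def)
qed

lemma val_inj: "val v = val w \<Longrightarrow> v = w"
proof -
  assume "val v = val w"
  then have "of_int (fst v - fst w) + of_int (snd v - snd w) * \<beta> = 0"
    using q_pos by (simp add: val_def algebra_simps)
  then show "v = w" using beta_irrational[of "fst v - fst w" "snd v - snd w"]
    by (simp add: prod_eq_iff)
qed

lemma val_beta_step_funpow: "val ((beta_step ^^ n) y) = (beta_T \<beta> ^^ n) (val y)"
  by (induction n) (simp_all add: val_beta_step)

lemma beta_step_funpow_range:
  assumes "0 \<le> val y" "val y < 1"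
  shows "0 \<le> val ((beta_step ^^ n) y)" "val ((beta_step ^^ n) y) < 1"
  using assms val_beta_step_range by (cases n; simp)+

text \<open>One step exchanges \<open>low\<close> and \<open>high\<close>, so the estimates close up
  only after two steps.\<close>

lemma tau_beta_step_funpow:
  assumes y: "0 \<le> val y" "val y < 1"
  shows "\<tau> (low ((beta_step ^^ (2 * n)) y)) \<le> \<beta>c ^ (2 * n) * \<tau> (low y)"
    "\<beta>c ^ (2 * n) * \<tau> (high y) \<le> \<tau> (high ((beta_step ^^ (2 * n)) y))"
proof (induction n)
  case (Suc n)
  define z where "z = (beta_step ^^ (2 * n)) y"
  have z: "0 \<le> val z" "val z < 1" using beta_step_funpow_range[OF y] by (auto simp: z_def)
  have z2: "(beta_step ^^ (2 * Suc n)) y = beta_step (beta_step z)" by (simp add: z_def)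
  {
    case 1
    have "\<tau> (low (beta_step (beta_step z))) \<le> \<beta>c * \<tau> (high (beta_step z))"
      by (intro tau_low_beta_step val_beta_step_range)
    also have "\<dots> \<le> \<beta>c * (\<beta>c * \<tau> (low z))"
      using conj_bounds tau_high_beta_step[OF z] by (intro mult_left_mono_neg) auto
    also have "\<dots> \<le> (\<beta>c * \<beta>c) * (\<beta>c ^ (2 * n) * \<tau> (low y))"
      unfolding mult.assoc[symmetric, of \<beta>c \<beta>c "\<tau> _"]
      using Suc.IH(1) by (intro mult_left_mono) (auto simp: z_def)
    finally show ?case unfolding z2 by (simp add: algebra_simps)
  next
    case 2
    have "(\<beta>c * \<beta>c) * (\<beta>c ^ (2 * n) * \<tau> (high y)) \<le> (\<beta>c * \<beta>c) * \<tau> (high z)"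
      using Suc.IH(2) by (intro mult_left_mono) (auto simp: z_def)
    also have "\<dots> = \<beta>c * (\<beta>c * \<tau> (high z))" by simp
    also have "\<dots> \<le> \<beta>c * \<tau> (low (beta_step z))"
      using conj_bounds tau_low_beta_step[OF z] by (intro mult_left_mono_neg) auto
    also have "\<dots> \<le> \<tau> (high (beta_step (beta_step z)))"
      by (intro tau_high_beta_step val_beta_step_range)
    finally show ?case unfolding z2 by (simp add: algebra_simps)
  }
qed simp_all

text \<open>Doubling the period makes it even; one round then compares \<tau> with itself times a
  factor below 1, which fixes its sign.\<close>

lemma tau_of_periodic:
  assumes y: "0 \<le> val y" "val y < 1" and p: "1 \<le> p" "(beta_step ^^ p) y = y"
  shows "\<tau> (low y) \<le> 0" "0 \<le> \<tau> (high y)"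
proof -
  have "(beta_step ^^ (2 * p)) y = y" by (simp add: mult_2 funpow_add p)
  then have le: "\<tau> (low y) \<le> \<beta>c ^ (2 * p) * \<tau> (low y)"
    "\<beta>c ^ (2 * p) * \<tau> (high y) \<le> \<tau> (high y)"
    using tau_beta_step_funpow[OF y, of p] by simp_all
  have "\<bar>\<beta>c\<bar> ^ (2 * p) < 1" using conj_bounds p by (simp add: power_less_one_iff)
  then have lt: "\<beta>c ^ (2 * p) < 1" by (simp add: power_even_abs)
  have "0 \<le> (\<beta>c ^ (2 * p) - 1) * \<tau> (low y)" using le by (simp add: algebra_simps)
  then show "\<tau> (low y) \<le> 0" using lt by (simp add: zero_le_mult_iff)
  have "(\<beta>c ^ (2 * p) - 1) * \<tau> (high y) \<le> 0" using le by (simp add: algebra_simps)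
  then show "0 \<le> \<tau> (high y)" using lt by (simp add: mult_le_0_iff)
qed

section \<open>Backward orbits inside the domain\<close>

definition periodic_dom :: "(int \<times> int) set" where
  "periodic_dom = {y. 0 \<le> val y \<and> val y < 1 \<and> \<tau> (low y) \<le> 0 \<and> 0 \<le> \<tau> (high y)}"

text \<open>The candidates are (w + d) / \<beta> with d congruent to -w modulo \<beta>. The two sign
  conditions on w become the signs of \<tau> at the two ends of the chain of candidates.\<close>

lemma periodic_dom_preimage:
  assumes "w \<in> periodic_dom"
  shows "\<exists>y\<in>periodic_dom. beta_step y = w"
proof -
  have w: "0 \<le> val w" "val w < 1" "\<tau> (low w) \<le> 0" "0 \<le> \<tau> (high w)"
    using assms by (auto simp: periodic_dom_def)
  define c :: int where "c = (if val w < \<beta> - of_int a then 0 else 1)"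
  define e where "e = digit (low w)"
  define f where "f = digit (high w)"
  obtain k where k: "fst (low w) = q * e + b * k" "shift (low w) = (snd (low w) - a * k, k)"
    using fst_decomp unfolding e_def .
  obtain l where l: "fst (high w) = q * f + b * l" "shift (high w) = (snd (high w) - a * l, l)"
    using fst_decomp unfolding f_def .
  have k1: "fst w = q + q * e + b * k" using k(1) by (simp add: low_def)
  have l1: "fst w = q * f + b * l - q * a + q * c"
    using l(1) by (auto simp: high_def c_def algebra_simps split: if_splits)
  have e: "0 \<le> e" "e < b" and f: "0 \<le> f" "f < b"
    using digit_bounds by (auto simp: e_def f_def)
  have c: "0 \<le> c" "c \<le> 1" by (auto simp: c_def)
  have eq: "q * (a - c - f + 1 + e) = b * (l - k)"
    using k1 l1 by (simp add: algebra_simps)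
  then have "b dvd a - c - f + 1 + e"
    using coprime_q_b by (metis coprime_commute coprime_dvd_mult_right_iff dvd_triv_left)
  then obtain j where j: "a - c - f + 1 + e = b * j" by blast
  have "0 < b * j" using j e f c ab by linarith
  then have "1 \<le> j" using b1 by (simp add: zero_less_mult_iff)
  \<comment> \<open>\<open>N\<close> is the last index: a - c - f is the largest digit of the
    residue class that does not exceed a - c. The bound b \<le> a, through j \<ge> 1, makes the
    chain nonempty.\<close>
  define N where "N = nat (j - 1)"
  have N: "int N + 1 = j" using \<open>1 \<le> j\<close> by (simp add: N_def)
  have "b * (l - k) = b * (q * j)" using eq j by (metis mult.left_commute)
  then have lk: "l = k + q * (int N + 1)" using b1 N by simp
  \<comment> \<open>\<open>Y i\<close> is (w + \<open>d i\<close>) / \<beta>. As w - 1 has residue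
    e, the least digit in the class of -w is b - 1 - e; the others follow in steps of b.\<close>
  define Y where "Y i = (snd w - a * (k + q * (int i + 1)), k + q * (int i + 1))" for i
  define d where "d i = b - 1 - e + int i * b" for i
  have dN: "d N = a - c - f" using j unfolding N[symmetric] by (simp add: d_def algebra_simps)
  have lowN: "low (Y N) = shift (high w)"
    using l(2) by (simp add: low_def Y_def lk high_def)
  have "\<tau> (low (Y N)) \<le> 0"
    unfolding lowN using w(4) tau_shift[of "high w"] conj_bounds by (simp add: zero_le_mult_iff)
  txt \<open>In the chain \<open>\<tau> (shift (low w)) \<ge> 0\<close>, \<open>\<tau> (low (Y 0))\<close>, ..., \<open>\<tau> (low (Y N)) \<le> 0\<close> the
    predecessor of \<open>\<tau> (low (Y i))\<close> is \<open>\<tau> (high (Y i))\<close>; take the first sign change.\<close>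
  define i where "i = (LEAST i. \<tau> (low (Y i)) \<le> 0)"
  have i: "\<tau> (low (Y i)) \<le> 0" unfolding i_def by (rule LeastI) fact
  have "i \<le> N" unfolding i_def by (rule Least_le) fact
  then have "d i \<le> d N" using b1 by (simp add: d_def)
  then have di: "d i \<le> a - c" using dN f by simp
  have d0: "0 \<le> d i" using e b1 by (simp add: d_def)
  have valY: "\<beta> * val (Y i) = val w + of_int (d i)"
  proof -
    define K where "K = k + q * (int i + 1)"
    have "fst w + q * d i = b * K" using k1 by (simp add: d_def K_def algebra_simps)
    then have "of_int (fst w) + of_int q * of_int (d i) = of_int b * real_of_int K"
      by (metis of_int_add of_int_mult)
    moreover have "of_int K * (\<beta> * \<beta>) = of_int K * (of_int a * \<beta> + of_int b)"
      using quad by (simp add: power2_eq_square)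
    moreover have "Y i = (snd w - a * K, K)" by (simp add: Y_def K_def)
    ultimately show ?thesis using q_pos by (simp add: val_def field_simps)
  qed
  have fl: "\<lfloor>\<beta> * val (Y i)\<rfloor> = d i" unfolding valY using w by linarith
  have "0 \<le> \<beta> * val (Y i)" using valY w d0 by simp
  then have vY0: "0 \<le> val (Y i)" using beta1 by (simp add: zero_le_mult_iff)
  \<comment> \<open>The correction c keeps w + \<open>d i\<close> below \<beta>: either w < \<beta>
    - a, or the digit is at most a - 1.\<close>
  have "real_of_int (d i) \<le> a - c" using di by linarith
  then have "val w + d i < \<beta>" using beta_gt w by (auto simp: c_def split: if_splits)
  then have "\<beta> * val (Y i) < \<beta> * 1" using valY by simp
  then have vY1: "val (Y i) < 1" using beta1 by (simp only: mult_less_cancel_left_pos)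
  have "b * (k + q * (int i + 1)) - q * d i = fst w"
    using k1 by (simp add: d_def algebra_simps)
  then have TY: "beta_step (Y i) = w" by (simp add: beta_step_def fl) (simp add: Y_def)
  have "0 \<le> \<tau> (high (Y i))"
  proof (cases i)
    case 0
    \<comment> \<open>The threshold \<beta> - a = b / \<beta> separates the least digit from the
      others, and this decides the branch of \<open>high\<close>.\<close>
    have "val w + d i < b" using w e by (simp add: d_def 0)
    then have "\<beta> * val (Y i) < \<beta> * (\<beta> - of_int a)" using valY beta_mult_frac by simp
    then have "val (Y i) < \<beta> - of_int a" using beta1 by (simp only: mult_less_cancel_left_pos)
    then have "high (Y i) = shift (low w)"
      using 0 k(2) by (simp add: high_def low_def Y_def algebra_simps)
    then show ?thesis
      using w(3) tau_shift[of "low w"] conj_bounds by (simp add: mult_le_0_iff)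
  next
    case (Suc i')
    have "1 * b \<le> int i * b" using b1 by (intro mult_right_mono) (auto simp: Suc)
    then have "b \<le> d i" using e unfolding d_def by linarith
    then have "real_of_int b \<le> val w + d i" using w by linarith
    then have "\<beta> * (\<beta> - of_int a) \<le> \<beta> * val (Y i)" using valY beta_mult_frac by simp
    then have "\<beta> - of_int a \<le> val (Y i)" using beta1 by (simp only: mult_le_cancel_left_pos)
    then have "high (Y i) = low (Y i')"
      by (simp add: high_def low_def Y_def Suc algebra_simps)
    moreover have "\<not> \<tau> (low (Y i')) \<le> 0"
      by (rule not_less_Least) (simp add: i_def[symmetric] Suc)
    ultimately show ?thesis by simp
  qed
  then have "Y i \<in> periodic_dom" using i vY0 vY1 by (simp add: periodic_dom_def)
  then show ?thesis using TY by blast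
qed

text \<open>Both embeddings are bounded: \<open>val\<close> by the unit interval, \<open>cnj\<close>
  by the two sign conditions and \<open>Pbound\<close>. Such bounds leave finitely many lattice
  points.\<close>

lemma finite_periodic_dom: "finite periodic_dom"
proof -
  define K where "K = Pbound + of_int a + 2"
  define R where "R = \<lceil>of_int q + of_int q * (K + 1) * \<beta>\<rceil>"
  have "periodic_dom \<subseteq> {-R..R} \<times> {-R..R}"
  proof
    fix y assume "y \<in> periodic_dom"
    then have y: "0 \<le> val y" "val y < 1" "\<tau> (low y) \<le> 0" "0 \<le> \<tau> (high y)"
      by (auto simp: periodic_dom_def)
    have a0: "real_of_int a \<ge> 1" using ab b1 by linarith
    have "cnj y - 1 \<le> Pbound" using y(3) Pval_bound[of "low y"] by (simp add: \<tau>_def cnj_low)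
    moreover have "- Pbound \<le> cnj y + \<beta>"
      using y(4) Pval_bound[of "high y"] by (auto simp: \<tau>_def cnj_high split: if_splits)
    ultimately have "\<bar>val y - cnj y\<bar> \<le> K + 1" using y beta_lt a0 unfolding K_def by linarith
    then have "\<bar>of_int (snd y) * (\<beta> - \<beta>c)\<bar> \<le> of_int q * (K + 1)"
      using q_pos unfolding val_cnj by (simp add: abs_mult field_simps)
    moreover have "\<bar>real_of_int (snd y)\<bar> * 1 \<le> \<bar>real_of_int (snd y)\<bar> * \<bar>\<beta> - \<beta>c\<bar>"
      using beta1 conj_bounds by (intro mult_left_mono) auto
    ultimately have s: "\<bar>real_of_int (snd y)\<bar> \<le> of_int q * (K + 1)"
      by (simp add: abs_mult)
    then have K0: "0 \<le> of_int q * (K + 1)" by linarith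
    have sb: "\<bar>real_of_int (snd y) * \<beta>\<bar> \<le> of_int q * (K + 1) * \<beta>"
      using s beta1 by (simp add: abs_mult)
    have "real_of_int (fst y) = of_int q * val y - of_int (snd y) * \<beta>"
      using q_pos by (simp add: val_def)
    moreover have "0 \<le> of_int q * val y" "of_int q * val y \<le> of_int q"
      using y q_pos by auto
    ultimately have r: "\<bar>real_of_int (fst y)\<bar> \<le> of_int q + of_int q * (K + 1) * \<beta>"
      using sb by linarith
    have "of_int q * (K + 1) * 1 \<le> of_int q * (K + 1) * \<beta>"
      using K0 beta1 by (intro mult_left_mono) auto
    then have s2: "\<bar>real_of_int (snd y)\<bar> \<le> of_int q + of_int q * (K + 1) * \<beta>"
      using s q_pos by linarith
    have "\<bar>fst y\<bar> \<le> R" "\<bar>snd y\<bar> \<le> R"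
      using r s2 unfolding R_def by linarith+
    then show "y \<in> {-R..R} \<times> {-R..R}" by (auto simp: mem_Times_iff)
  qed
  then show ?thesis by (rule finite_subset) auto
qed

text \<open>A backward orbit of y in a finite set repeats; applying \<open>beta_step\<close> to the
  repetition brings it back to y.\<close>

lemma periodic_dom_periodic:
  assumes "y \<in> periodic_dom"
  shows "\<exists>p\<ge>1. (beta_step ^^ p) y = y"
proof -
  obtain g where g: "\<And>w. w \<in> periodic_dom \<Longrightarrow> g w \<in> periodic_dom \<and> beta_step (g w) = w"
    using periodic_dom_preimage by metis
  have gd: "(g ^^ n) y \<in> periodic_dom" for n
    by (induction n) (use assms g in auto)
  have inv: "(beta_step ^^ n) ((g ^^ (n + m)) y) = (g ^^ m) y" for n m
  proof (induction n)
    case (Suc n)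
    have "beta_step ((g ^^ (Suc n + m)) y) = (g ^^ (n + m)) y"
      using g gd[of "n + m"] by simp
    then show ?case using Suc by (simp add: funpow_Suc_right del: funpow.simps)
  qed simp
  have "\<not> inj (\<lambda>n. (g ^^ n) y)"
    using finite_subset[OF _ finite_periodic_dom, of "range (\<lambda>n. (g ^^ n) y)"] gd
    by (meson finite_imageD image_subsetI infinite_UNIV_nat)
  then obtain i' j' where "i' \<noteq> j'" "(g ^^ i') y = (g ^^ j') y" unfolding inj_def by blast
  then obtain i j where ij: "i < j" "(g ^^ i) y = (g ^^ j) y"
    using that[of i' j'] that[of j' i'] by (metis linorder_neqE_nat)
  have "y = (g ^^ (j - i)) y"
    using inv[of i 0] inv[of i "j - i"] ij by simp
  then have "(beta_step ^^ (j - i)) y = y"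
    using inv[of "j - i" 0] by simp
  then show ?thesis using ij(1) by (intro exI[of _ "j - i"]) auto
qed

end

subsection \<open>Approximation of rationals by integers\<close>

text \<open>The case q = 1 is Z[\<beta>] itself; \<open>one.word\<close> turns out to be the
  \<beta>-adic expansion.\<close>

sublocale quad_pisot \<subseteq> one: quad_frac a b \<beta> 1 1
  by unfold_locales auto

context quad_frac
begin

text \<open>As v carries the denominator q, the hypotheses say that v - w lies in (b^n / q)
  Z[\<beta>]. Each shift costs one factor b.\<close>

lemma word_agree:
  assumes "[fst v = q * fst w] (mod b ^ n)" "[snd v = q * snd w] (mod b ^ n)" "i < n"
  shows "word v i = one.word w i"
  using assms
proof (induction n arbitrary: v w i)
  case (Suc n)
  obtain k where k: "fst v = q * digit v + b * k" "shift v = (snd v - a * k, k)"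
    using fst_decomp .
  obtain l where l: "fst w = 1 * one.digit w + b * l" "one.shift w = (snd w - a * l, l)"
    using one.fst_decomp .
  have d1: "b * b ^ n dvd fst v - q * fst w" and d2: "b * b ^ n dvd snd v - q * snd w"
    using Suc.prems by (simp_all add: cong_iff_dvd_diff)
  have "[fst v = q * fst w] (mod b)"
    using d1 by (meson cong_iff_dvd_diff dvd_mult_left)
  then have "[fst v * qi = q * fst w * qi] (mod b)" by (intro cong_mult cong_refl)
  moreover have "[q * qi * fst w = 1 * fst w] (mod b)" by (intro cong_mult cong_refl qi)
  ultimately have "[fst v * qi = fst w] (mod b)" by (simp add: cong_def ac_simps)
  then have dgs: "digit v = one.digit w" by (simp add: digit_def one.digit_def cong_def)
  have "b * b ^ n dvd b * (k - q * l)"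
    using d1 k(1) l(1) dgs by (simp add: algebra_simps)
  then have kl: "b ^ n dvd k - q * l" using b1 by simp
  have "b ^ n dvd (snd v - q * snd w) - a * (k - q * l)"
    using kl d2[THEN dvd_mult_right] by (metis dvd_diff dvd_mult)
  also have "(snd v - q * snd w) - a * (k - q * l) = (snd v - a * k) - q * (snd w - a * l)"
    by (simp add: algebra_simps)
  finally have kl2: "b ^ n dvd (snd v - a * k) - q * (snd w - a * l)" .
  show ?case
  proof (cases i)
    case 0
    then show ?thesis by (simp add: word_0 one.word_0 dgs)
  next
    case (Suc i')
    have "word (shift v) i' = one.word (one.shift w) i'"
      using kl kl2 Suc.prems(3) Suc by (intro Suc.IH) (auto simp: k(2) l(2) cong_iff_dvd_diff)
    then show ?thesis by (simp add: Suc word_Suc one.word_Suc)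
  qed
qed simp

lemma Pval_close:
  assumes "[fst v = q * fst w] (mod b ^ n)" "[snd v = q * snd w] (mod b ^ n)"
  shows "\<bar>Pval v - one.Pval w\<bar> \<le> 2 * Pbound * \<bar>\<beta>c\<bar> ^ n"
proof -
  have "(\<Sum>i<n. of_int (word v i) * \<beta>c ^ i) = (\<Sum>i<n. of_int (one.word w i) * \<beta>c ^ i)"
    using word_agree[OF assms] by (intro sum.cong) auto
  then have "Pval v - one.Pval w = \<beta>c ^ n * (Pval ((shift ^^ n) v) - one.Pval ((one.shift ^^ n) w))"
    using Pval_split[of v n] one.Pval_split[of w n] by (simp add: algebra_simps)
  moreover have "\<bar>Pval ((shift ^^ n) v) - one.Pval ((one.shift ^^ n) w)\<bar> \<le> 2 * Pbound"
    using Pval_bound[of "(shift ^^ n) v"] one.Pval_bound[of "(one.shift ^^ n) w"] by linarith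
  ultimately show ?thesis
    by (simp add: abs_mult power_abs mult.commute[of _ "\<bar>\<beta>c\<bar> ^ n"] mult_left_mono)
qed

lemma small_power:
  assumes "0 < \<epsilon>"
  obtains n where "2 * Pbound * \<bar>\<beta>c\<bar> ^ n < \<epsilon>"
proof -
  have "(\<lambda>n. \<bar>\<beta>c\<bar> ^ n) \<longlonglongrightarrow> 0"
    using conj_bounds by (intro LIMSEQ_realpow_zero) auto
  then have "(\<lambda>n. 2 * Pbound * \<bar>\<beta>c\<bar> ^ n) \<longlonglongrightarrow> 2 * Pbound * 0"
    by (intro tendsto_mult_left)
  then have "\<forall>\<^sub>F n in sequentially. 2 * Pbound * \<bar>\<beta>c\<bar> ^ n < \<epsilon>"
    using assms by (intro order_tendstoD) auto
  then show ?thesis using that by (auto simp: eventually_sequentially)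
qed

text \<open>With i an inverse of q modulo b^n, the integer i r is \<beta>-adically close to r /
  q.\<close>

lemma Pval_approx:
  assumes "0 < \<epsilon>"
  obtains j where "\<bar>Pval (r, q * t) - one.Pval (j, t)\<bar> < \<epsilon>"
proof -
  obtain n where n: "2 * Pbound * \<bar>\<beta>c\<bar> ^ n < \<epsilon>" using small_power[OF assms] .
  have "coprime q (b ^ n)" using coprime_q_b by simp
  then obtain i where "[q * i = 1] (mod b ^ n)" using cong_solve_coprime_int by blast
  then have "[q * i * r = 1 * r] (mod b ^ n)" by (intro cong_mult cong_refl)
  then have "[r = q * (i * r)] (mod b ^ n)" by (simp add: cong_sym mult.assoc)
  then have "\<bar>Pval (r, q * t) - one.Pval (i * r, t)\<bar> \<le> 2 * Pbound * \<bar>\<beta>c\<bar> ^ n"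
    by (intro Pval_close) auto
  then show ?thesis using n by (intro that[of "i * r"]) linarith
qed

lemma bdd_Pval: "bdd_below (range (\<lambda>j. Pval (j, t)))" "bdd_above (range (\<lambda>j. Pval (j, t)))"
proof -
  have "- Pbound \<le> Pval (j, t)" "Pval (j, t) \<le> Pbound" for j
    using Pval_bound[of "(j, t)"] by linarith+
  then show "bdd_below (range (\<lambda>j. Pval (j, t)))" "bdd_above (range (\<lambda>j. Pval (j, t)))"
    by (auto intro!: bdd_belowI[of _ "- Pbound"] bdd_aboveI[of _ Pbound])
qed

end

context quad_frac
begin

lemma Pval_ge_INF: "(INF j. one.Pval (j, t)) \<le> Pval (r, q * t)"
proof (rule field_le_epsilon)
  fix \<epsilon> :: real assume "0 < \<epsilon>"
  then obtain j where "\<bar>Pval (r, q * t) - one.Pval (j, t)\<bar> < \<epsilon>" using Pval_approx by blast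
  moreover have "(INF j. one.Pval (j, t)) \<le> one.Pval (j, t)"
    by (rule cINF_lower[OF one.bdd_Pval(1)]) simp
  ultimately show "(INF j. one.Pval (j, t)) \<le> Pval (r, q * t) + \<epsilon>" by linarith
qed

lemma Pval_le_SUP: "Pval (r, q * t) \<le> (SUP j. one.Pval (j, t))"
proof (rule field_le_epsilon)
  fix \<epsilon> :: real assume "0 < \<epsilon>"
  then obtain j where "\<bar>Pval (r, q * t) - one.Pval (j, t)\<bar> < \<epsilon>" using Pval_approx by blast
  moreover have "one.Pval (j, t) \<le> (SUP j. one.Pval (j, t))"
    by (rule cSUP_upper[OF _ one.bdd_Pval(2)]) simp
  ultimately show "Pval (r, q * t) \<le> (SUP j. one.Pval (j, t)) + \<epsilon>" by linarith
qed

end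

subsection \<open>Digits and orbits\<close>

text \<open>With equal digits, each step multiplies the distance of the orbits by \<beta>, yet it
  stays below 1.\<close>

lemma beta_T_digits_eq:
  assumes "1 < \<beta>" "0 \<le> x" "x < 1" "0 \<le> y" "y < 1"
    and eq: "\<And>k. 1 \<le> k \<Longrightarrow> beta_digit \<beta> x k = beta_digit \<beta> y k"
  shows "x = y"
proof (rule ccontr)
  assume "x \<noteq> y"
  have fl: "\<lfloor>\<beta> * (beta_T \<beta> ^^ n) x\<rfloor> = \<lfloor>\<beta> * (beta_T \<beta> ^^ n) y\<rfloor>" for n
    using eq[of "Suc n"] by (simp add: beta_digit_def)
  have diff: "(beta_T \<beta> ^^ n) x - (beta_T \<beta> ^^ n) y = \<beta> ^ n * (x - y)" for n
  proof (induction n)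
    case (Suc n)
    have "(beta_T \<beta> ^^ Suc n) x - (beta_T \<beta> ^^ Suc n) y
        = \<beta> * ((beta_T \<beta> ^^ n) x - (beta_T \<beta> ^^ n) y)"
      using fl[of n] by (simp add: beta_T_def right_diff_distrib)
    then show ?case using Suc by simp
  qed simp
  have bounds: "0 \<le> (beta_T \<beta> ^^ n) z \<and> (beta_T \<beta> ^^ n) z < 1" if "0 \<le> z" "z < 1" for n z
  proof (cases n)
    case (Suc m)
    have "0 \<le> beta_T \<beta> u \<and> beta_T \<beta> u < 1" for u unfolding beta_T_def by linarith
    then show ?thesis by (simp add: Suc)
  qed (use that in auto)
  obtain n where n: "1 / \<bar>x - y\<bar> < \<beta> ^ n" using real_arch_pow[OF assms(1)] by blast
  then have "1 < \<beta> ^ n * \<bar>x - y\<bar>" using \<open>x \<noteq> y\<close> by (simp add: field_simps)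
  also have "\<dots> = \<bar>(beta_T \<beta> ^^ n) x - (beta_T \<beta> ^^ n) y\<bar>"
    using assms(1) by (simp add: diff abs_mult)
  finally show False using bounds[of x n] bounds[of y n] assms by linarith
qed

lemma purely_periodic_iff:
  assumes "1 < \<beta>" "0 \<le> x" "x < 1"
  shows "purely_periodic_beta \<beta> x \<longleftrightarrow> (\<exists>p\<ge>1. (beta_T \<beta> ^^ p) x = x)"
proof -
  have shift: "beta_digit \<beta> x (k + p) = beta_digit \<beta> ((beta_T \<beta> ^^ p) x) k" if "1 \<le> k" for k p
  proof -
    \<comment> \<open>Digits are numbered from 1, so digit k + p is read off the iterate of order (k
      - 1) + p.\<close>
    have "k + p - 1 = (k - 1) + p" using that by simp
    then show ?thesis by (simp only: beta_digit_def funpow_add o_apply)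
  qed
  have bounds: "0 \<le> (beta_T \<beta> ^^ p) x \<and> (beta_T \<beta> ^^ p) x < 1" if "1 \<le> p" for p
  proof -
    obtain m where "p = Suc m" using \<open>1 \<le> p\<close> by (cases p) auto
    moreover have "0 \<le> beta_T \<beta> u \<and> beta_T \<beta> u < 1" for u unfolding beta_T_def by linarith
    ultimately show ?thesis by simp
  qed
  show ?thesis unfolding purely_periodic_beta_def
  proof (intro iffI; elim exE conjE)
    fix p :: nat assume "1 \<le> p" "\<forall>k\<ge>1. beta_digit \<beta> x (k + p) = beta_digit \<beta> x k"
    then have "(beta_T \<beta> ^^ p) x = x"
      using shift bounds assms by (intro beta_T_digits_eq[OF assms(1)]) auto
    then show "\<exists>p\<ge>1. (beta_T \<beta> ^^ p) x = x" using \<open>1 \<le> p\<close> by blast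
  next
    fix p :: nat assume "1 \<le> p" "(beta_T \<beta> ^^ p) x = x"
    then show "\<exists>p\<ge>1. \<forall>k\<ge>1. beta_digit \<beta> x (k + p) = beta_digit \<beta> x k"
      using shift by auto
  qed
qed

lemma (in quad_frac) purely_periodic_iff_tau:
  assumes "0 \<le> val y" "val y < 1"
  shows "purely_periodic_beta \<beta> (val y) \<longleftrightarrow> \<tau> (low y) \<le> 0 \<and> 0 \<le> \<tau> (high y)"
proof -
  have "purely_periodic_beta \<beta> (val y) \<longleftrightarrow> (\<exists>p\<ge>1. (beta_step ^^ p) y = y)"
    unfolding purely_periodic_iff[OF beta1 assms] val_beta_step_funpow[symmetric]
    by (auto dest: val_inj)
  also have "\<dots> \<longleftrightarrow> \<tau> (low y) \<le> 0 \<and> 0 \<le> \<tau> (high y)"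
    using tau_of_periodic[OF assms] periodic_dom_periodic[of y] assms by (auto simp: periodic_dom_def)
  finally show ?thesis .
qed

text \<open>A rational number is its own conjugate, which makes the conditions on \<tau> explicit.
  The arguments of \<open>Pval\<close> keep the shape \<open>(p + q * m, q * t)\<close> that the
  approximation lemmas expect.\<close>

lemma (in quad_frac) purely_periodic_rational_iff:
  fixes p :: int
  defines "x \<equiv> of_int p / of_int q"
  defines "c \<equiv> if x < \<beta> - of_int a then 0 else 1"
  assumes "0 \<le> x" "x < 1"
  shows "purely_periodic_beta \<beta> x \<longleftrightarrow>
    x - 1 \<le> Pval (p + q * (-1), q * 0) \<and> Pval (p + q * (a - c), q * (-1)) \<le> \<beta> - of_int c + x"
proof -
  have x: "val (p, 0) = x" "cnj (p, 0) = x" by (simp_all add: val_def cnj_def x_def)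
  have "low (p, 0) = (p + q * (-1), q * 0)" by (simp add: low_def)
  moreover have "high (p, 0) = (p + q * (a - c), q * (-1))"
    by (simp add: high_def x c_def algebra_simps)
  ultimately show ?thesis
    using purely_periodic_iff_tau[of "(p, 0)"] assms(3,4) cnj_low[of "(p, 0)"] cnj_high[of "(p, 0)"]
    by (auto simp: x \<tau>_def c_def)
qed

section \<open>The \<beta>-adic expansion and fractions \<beta>-adically close to integers\<close>

context quad_pisot
begin

text \<open>For uniqueness, at the first position where two expansions could differ the difference
  of the digits is an integer divisible by \<beta> in Z[\<beta>], hence by b.\<close>

lemma beta_adic_eq: "beta_adic \<beta> b (of_int m + of_int n * \<beta>) = one.word (m, n)"
proof -
  define x where "x = of_int m + of_int n * \<beta>"
  define P where "P u \<longleftrightarrow> (\<forall>n. 0 \<le> u n \<and> u n < b) \<and>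
      (\<forall>n. \<exists>z\<in>Zbeta \<beta>. x - (\<Sum>i<n. of_int (u i) * \<beta> ^ i) = \<beta> ^ n * z)" for u
  have x: "x = one.val (m, n)" by (simp add: x_def one.val_def)
  have "P (one.word (m, n))"
    unfolding P_def
  proof (intro conjI allI)
    fix k
    show "0 \<le> one.word (m, n) k" "one.word (m, n) k < b"
      using one.digit_bounds by (auto simp: one.word_def)
    have "one.val ((one.shift ^^ k) (m, n)) \<in> Zbeta \<beta>"
      unfolding Zbeta_eq one.val_def by auto
    then show "\<exists>z\<in>Zbeta \<beta>. x - (\<Sum>i<k. of_int (one.word (m, n) i) * \<beta> ^ i) = \<beta> ^ k * z"
      using one.val_split[of "(m, n)" k] unfolding x by force
  qed
  moreover have "u = w" if u: "P u" and w: "P w" for u w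
  proof
    fix k
    show "u k = w k"
    proof (induction k rule: less_induct)
      case (less k)
      obtain y where y: "y \<in> Zbeta \<beta>"
        "x - (\<Sum>i<Suc k. of_int (u i) * \<beta> ^ i) = \<beta> ^ Suc k * y"
        using u unfolding P_def by blast
      obtain z where z: "z \<in> Zbeta \<beta>"
        "x - (\<Sum>i<Suc k. of_int (w i) * \<beta> ^ i) = \<beta> ^ Suc k * z"
        using w unfolding P_def by blast
      obtain y1 y2 z1 z2 where yz: "y = of_int y1 + of_int y2 * \<beta>" "z = of_int z1 + of_int z2 * \<beta>"
        using y z unfolding Zbeta_eq by blast
      have "(\<Sum>i<k. of_int (u i) * \<beta> ^ i) = (\<Sum>i<k. of_int (w i) * \<beta> ^ i)"
        using less by (intro sum.cong) auto
      then have "\<beta> ^ k * (of_int (u k) - of_int (w k)) = \<beta> ^ k * (\<beta> * (z - y))"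
        using y(2) z(2) by (simp add: algebra_simps)
      then have "of_int (u k) - of_int (w k) = \<beta> * (z - y)" using beta1 by simp
      also have "\<dots> = of_int (z1 - y1) * \<beta> + of_int (z2 - y2) * \<beta>\<^sup>2"
        by (simp add: yz algebra_simps power2_eq_square)
      finally have "of_int (u k - w k - (z2 - y2) * b)
          + of_int (- (z1 - y1) - (z2 - y2) * a) * \<beta> = 0"
        unfolding quad by (simp add: algebra_simps)
      then have "u k - w k = (z2 - y2) * b" using beta_irrational by fastforce
      then have "[u k = w k] (mod b)" by (simp add: cong_iff_dvd_diff)
      then show ?case using u w by (simp add: P_def cong_def)
    qed
  qed
  ultimately have "(THE u. P u) = one.word (m, n)" by (intro the_equality) auto
  then show ?thesis unfolding beta_adic_def P_def x_def .
qed

text \<open>Simultaneous approximation at the real place and at the primes dividing b: the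
  admissible p give points of spacing b^n / q, and q is taken large.\<close>

lemma exists_fraction:
  fixes l r :: real
  assumes "l < r"
  obtains p q :: int where "0 < q" "[q = 1] (mod b ^ n)" "[p = j] (mod b ^ n)"
    "l < of_int p / of_int q" "of_int p / of_int q < r"
proof -
  define M where "M = b ^ n"
  have M: "1 \<le> M" using b1 by (simp add: M_def)
  obtain N :: nat where N: "of_int M / (r - l) < real N" using reals_Archimedean2 by blast
  define q where "q = 1 + int N * M"
  \<comment> \<open>The least integer that puts (j + M t) / q above l.\<close>
  define t where "t = \<lfloor>(of_int q * l - of_int j) / of_int M\<rfloor> + 1"
  define p where "p = j + M * t"
  have q: "0 < q" using M by (simp add: q_def add_pos_nonneg)
  have "real N * 1 \<le> real N * of_int M" using M by (intro mult_left_mono) auto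
  then have "real N \<le> of_int q" by (simp add: q_def)
  then have "of_int M / (r - l) < of_int q" using N by linarith
  then have qM: "of_int M < of_int q * (r - l)" using assms by (simp add: field_simps)
  have t: "(of_int q * l - of_int j) / of_int M < of_int t"
    "of_int t \<le> (of_int q * l - of_int j) / of_int M + 1" unfolding t_def by linarith+
  have "of_int q * l < of_int p" using t(1) M by (simp add: p_def field_simps)
  then have 1: "l < of_int p / of_int q" using q by (simp add: field_simps)
  have "of_int p \<le> of_int q * l + of_int M" using t(2) M by (simp add: p_def field_simps)
  then have "of_int p < of_int q * r" using qM by (simp add: algebra_simps)
  then have 2: "of_int p / of_int q < r" using q by (simp add: field_simps)
  show ?thesis
    using that[OF q _ _ 1 2] by (simp add: q_def p_def M_def cong_iff_dvd_diff)
qed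

text \<open>Converse to \<open>Pval_approx\<close>: the value at an integer point is approached by
  fractions from any prescribed real interval.\<close>

lemma exists_fraction_Pval:
  fixes l r :: real
  assumes "l < r" "0 < \<epsilon>"
  obtains p q qi :: int where "quad_frac a b \<beta> q qi"
    "l < of_int p / of_int q" "of_int p / of_int q < r"
    "\<bar>quad_frac.Pval a b \<beta> q qi (p + q * m, q * t) - one.Pval (j, t)\<bar> < \<epsilon>"
proof -
  obtain n where n: "2 * one.Pbound * \<bar>\<beta>c\<bar> ^ n < \<epsilon>" using one.small_power[OF assms(2)] .
  \<comment> \<open>The exponent \<open>Suc n\<close> gives q congruent to 1 modulo b even for n =
    0, so that 1 serves as \<open>qi\<close>; the term -m offsets the translation by m.\<close>
  obtain p q :: int where pq: "0 < q" "[q = 1] (mod b ^ Suc n)" "[p = j - m] (mod b ^ Suc n)"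
    "l < of_int p / of_int q" "of_int p / of_int q < r"
    using exists_fraction[OF assms(1)] .
  have "[q * 1 = 1] (mod b)"
    using pq(2) by (simp add: cong_iff_dvd_diff) (metis dvd_mult_left)
  then interpret f: quad_frac a b \<beta> q 1
    using pq(1) by unfold_locales auto
  have q1: "[q = 1] (mod b ^ n)" "[p = j - m] (mod b ^ n)"
    using pq(2,3) by (auto simp: cong_iff_dvd_diff dest: dvd_mult_right)
  have "[p + q * m = (j - m) + 1 * m] (mod b ^ n)"
    using q1 by (intro cong_add cong_mult cong_refl)
  moreover have "[q * j = 1 * j] (mod b ^ n)" using q1 by (intro cong_mult cong_refl)
  ultimately have "[p + q * m = q * j] (mod b ^ n)" by (simp add: cong_def)
  then have "\<bar>f.Pval (p + q * m, q * t) - one.Pval (j, t)\<bar> \<le> 2 * one.Pbound * \<bar>\<beta>c\<bar> ^ n"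
    by (intro f.Pval_close) auto
  then show ?thesis
    using that[OF f.quad_frac_axioms pq(4,5)] n by linarith
qed

subsection \<open>Rationals without purely periodic expansion\<close>

definition nonper :: "real set" where
  "nonper = {x. (\<exists>p q::int. q > 0 \<and> gcd q b = 1 \<and> x = of_int p / of_int q)
                 \<and> 0 \<le> x \<and> x < 1 \<and> \<not> purely_periodic_beta \<beta> x}"

text \<open>Only r \<le> 1 has to be tested, since 1 belongs to the set.\<close>

lemma gamma_eqI:
  assumes "\<And>x. x \<in> nonper \<Longrightarrow> g \<le> x" "g \<le> 1"
    and "\<And>r. g < r \<Longrightarrow> r \<le> 1 \<Longrightarrow> \<exists>x\<in>nonper. x < r"
  shows "gamma_beta \<beta> b = g"
proof -
  have "Inf (nonper \<union> {1}) = g"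
  proof (rule cInf_eq_non_empty)
    fix y assume y: "\<And>x. x \<in> nonper \<union> {1} \<Longrightarrow> y \<le> x"
    show "y \<le> g"
    proof (rule ccontr)
      assume "\<not> y \<le> g"
      then obtain x where "x \<in> nonper" "x < y" using assms(3)[of y] y[of 1] by auto
      then show False using y[of x] by simp
    qed
  qed (use assms in auto)
  then show ?thesis by (simp add: gamma_beta_def nonper_def)
qed

lemma quad_frac_nonperI:
  assumes "quad_frac a b \<beta> q qi" "0 \<le> real_of_int p / of_int q" "real_of_int p / of_int q < 1"
    "\<not> purely_periodic_beta \<beta> (of_int p / of_int q)"
  shows "real_of_int p / of_int q \<in> nonper"
proof -
  interpret f: quad_frac a b \<beta> q qi by fact
  show ?thesis using assms(2-4) f.q_pos f.coprime_q_b
    unfolding nonper_def coprime_iff_gcd_eq_1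
    by (intro CollectI conjI exI[of _ p] exI[of _ q]) auto
qed

text \<open>For x > l, pure periodicity needs P_h(x-1)(\<beta>') \<ge> x - 1 > l - 1. This fails if
  x - 1 is \<beta>-adically close enough to j.\<close>

lemma nonper_low:
  assumes "one.Pval (j, 0) < l - 1" "0 \<le> l" "l < r" "r \<le> 1"
  shows "\<exists>x\<in>nonper. l < x \<and> x < r"
proof -
  define \<epsilon> where "\<epsilon> = l - 1 - one.Pval (j, 0)"
  have "0 < \<epsilon>" using assms by (simp add: \<epsilon>_def)
  then obtain p q qi where f: "quad_frac a b \<beta> q qi"
    and x: "l < of_int p / of_int q" "of_int p / of_int q < r"
    and close: "\<bar>quad_frac.Pval a b \<beta> q qi (p + q * (-1), q * 0) - one.Pval (j, 0)\<bar> < \<epsilon>"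
    using exists_fraction_Pval[OF assms(3)] by metis
  have "\<not> of_int p / of_int q - 1 \<le> quad_frac.Pval a b \<beta> q qi (p + q * (-1), q * 0)"
    using close x unfolding \<epsilon>_def by linarith
  then have "\<not> purely_periodic_beta \<beta> (of_int p / of_int q)"
    using quad_frac.purely_periodic_rational_iff[OF f, of p] x assms by linarith
  then show ?thesis using quad_frac_nonperI[OF f] x assms by force
qed

text \<open>As in \<open>nonper_low\<close>, with the upper condition. The interval lies on one side
  of \<beta> - a, so that c is constant on it.\<close>

lemma nonper_high:
  assumes "\<beta> - of_int c + r < one.Pval (j, -1)" "0 \<le> l" "l < r" "r \<le> 1"
    and "c = 0 \<and> r \<le> \<beta> - of_int a \<or> c = 1 \<and> \<beta> - of_int a \<le> l"
  shows "\<exists>x\<in>nonper. l < x \<and> x < r"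
proof -
  define \<epsilon> where "\<epsilon> = one.Pval (j, -1) - (\<beta> - of_int c + r)"
  have "0 < \<epsilon>" using assms by (simp add: \<epsilon>_def)
  then obtain p q qi where f: "quad_frac a b \<beta> q qi"
    and x: "l < of_int p / of_int q" "of_int p / of_int q < r"
    and close: "\<bar>quad_frac.Pval a b \<beta> q qi (p + q * (a - c), q * (-1)) - one.Pval (j, -1)\<bar> < \<epsilon>"
    using exists_fraction_Pval[OF assms(3)] by metis
  have c: "(if of_int p / of_int q < \<beta> - of_int a then 0 else 1) = c"
    using assms(5) x by auto
  have "\<not> quad_frac.Pval a b \<beta> q qi (p + q * (a - c), q * (-1)) \<le> \<beta> - of_int c + of_int p / of_int q"
    using close x unfolding \<epsilon>_def by linarith
  then have "\<not> purely_periodic_beta \<beta> (of_int p / of_int q)"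
    using quad_frac.purely_periodic_rational_iff[OF f, of p] x assms unfolding c by linarith
  then show ?thesis using quad_frac_nonperI[OF f] x assms by force
qed

lemma nonper_lower:
  assumes "x \<in> nonper"
  shows "(INF j. one.Pval (j, 0)) < x - 1 \<or>
    (if x < \<beta> - of_int a then \<beta> + x else \<beta> - 1 + x) < (SUP j. one.Pval (j, -1))"
proof -
  obtain p q where pq: "0 < q" "gcd q b = 1" "x = of_int p / of_int q"
    and x: "0 \<le> x" "x < 1" "\<not> purely_periodic_beta \<beta> x"
    using assms by (auto simp: nonper_def)
  then obtain qi where "[q * qi = 1] (mod b)"
    using cong_solve_coprime_int by (metis coprime_iff_gcd_eq_1)
  then interpret f: quad_frac a b \<beta> q qi using pq(1) by unfold_locales
  show ?thesis
    using f.purely_periodic_rational_iff[of p] x f.Pval_ge_INF[of 0 "p + q * (-1)"]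
      f.Pval_le_SUP[of "p + q * (a - (if x < \<beta> - of_int a then 0 else 1))" "-1"]
    unfolding pq(3)[symmetric] by (auto split: if_splits)
qed

end

section \<open>The three cases of the formula\<close>

theorem theorem1:
  fixes a b :: int and \<beta> :: real
  assumes "a \<ge> b" and "b \<ge> 1"
    and "\<beta> > 1" and "\<beta>\<^sup>2 = of_int a * \<beta> + of_int b"
  shows "gamma_beta \<beta> b =
    (let \<beta>' = of_int a - \<beta>;
         S = (SUP j::int. Pword (beta_adic \<beta> b (of_int j - \<beta>)) \<beta>');
         I = (INF j::int. Pword (beta_adic \<beta> b (of_int j)) \<beta>')
     in if S > \<beta> \<or> I < -1 then 0
        else if S \<in> {2 * \<beta> - of_int a - 1 <.. \<beta>} \<and> I \<ge> \<beta> - of_int a - 1 then \<beta> - of_int a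
        else 1 + I)"
proof -
  interpret quad_pisot a b \<beta> using assms by unfold_locales auto
  define S where "S = (SUP j::int. one.Pval (j, -1))"
  define I where "I = (INF j::int. one.Pval (j, 0))"
  have "Pword (beta_adic \<beta> b (of_int j - \<beta>)) \<beta>c = one.Pval (j, -1)" for j
    using beta_adic_eq[of j "-1"] by (simp add: one.Pval_def)
  then have S: "(SUP j::int. Pword (beta_adic \<beta> b (of_int j - \<beta>)) \<beta>c) = S"
    by (simp add: S_def)
  have "Pword (beta_adic \<beta> b (of_int j)) \<beta>c = one.Pval (j, 0)" for j
    using beta_adic_eq[of j 0] by (simp add: one.Pval_def)
  then have I: "(INF j::int. Pword (beta_adic \<beta> b (of_int j)) \<beta>c) = I"
    by (simp add: I_def)
  have S_less: "\<exists>j. y < one.Pval (j, -1)" if "y < S" for y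
    using that less_cSUP_iff[OF _ one.bdd_Pval(2)[of "-1"]] by (auto simp: S_def)
  have I_less: "\<exists>j. one.Pval (j, 0) < y" if "I < y" for y
    using that cINF_less_iff[OF _ one.bdd_Pval(1)[of 0]] by (auto simp: I_def)
  have lower: "I < x - 1 \<or> (if x < \<beta> - of_int a then \<beta> + x else \<beta> - 1 + x) < S"
    if "x \<in> nonper" for x
    using nonper_lower[OF that] by (simp add: S_def I_def)
  have nonneg: "0 \<le> x" if "x \<in> nonper" for x using that by (simp add: nonper_def)
  \<comment> \<open>The word of 0 is zero, so I \<le> 0; this gives 1 + I \<le> 1 in the last
    case.\<close>
  have "one.shift (0, 0) = (0, 0)" "one.digit (0, 0) = 0"
    by (simp_all add: one.shift_def one.digit_def)
  then have "one.Pval (0, 0) = \<beta>c * one.Pval (0, 0)" using one.Pval_shift[of "(0, 0)"] by simp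
  then have "one.Pval (0, 0) = 0" using conj_bounds by simp
  then have I0: "I \<le> 0"
    using cINF_lower[OF one.bdd_Pval(1)[of 0], of 0] by (simp add: I_def)
  consider (zero) "S > \<beta> \<or> I < -1"
    | (middle) "I \<ge> -1" "S \<in> {2 * \<beta> - of_int a - 1 <.. \<beta>}" "I \<ge> \<beta> - of_int a - 1"
    | (other) "I \<ge> -1" "S \<le> \<beta>" "S \<le> 2 * \<beta> - of_int a - 1 \<or> I < \<beta> - of_int a - 1"
    by force
  then have "gamma_beta \<beta> b = (if S > \<beta> \<or> I < -1 then 0
        else if S \<in> {2 * \<beta> - of_int a - 1 <.. \<beta>} \<and> I \<ge> \<beta> - of_int a - 1 then \<beta> - of_int a
        else 1 + I)"
  proof cases
    case zero
    have "gamma_beta \<beta> b = 0"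
    proof (rule gamma_eqI)
      fix r :: real assume r: "0 < r" "r \<le> 1"
      from zero show "\<exists>x\<in>nonper. x < r"
      proof
        assume "S > \<beta>"
        then obtain j where j: "\<beta> < one.Pval (j, -1)" using S_less by blast
        \<comment> \<open>Small enough for the branch c = 0 and for \<beta> + r' to stay below the
          chosen value.\<close>
        define r' where "r' = min r (min (\<beta> - of_int a) ((one.Pval (j, -1) - \<beta>) / 2))"
        have "\<beta> - of_int 0 + r' < one.Pval (j, -1)" "0 < r'" "r' \<le> 1" "r' \<le> r"
          "r' \<le> \<beta> - of_int a"
          using r j beta_gt by (auto simp: r'_def min_def field_simps)
        then show ?thesis using nonper_high[of 0 r' j 0] by force
      next
        assume "I < -1"
        then obtain j where "one.Pval (j, 0) < 0 - 1" using I_less by force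
        then show ?thesis using nonper_low[of j 0 r] r by blast
      qed
    qed (use nonneg in auto)
    then show ?thesis using zero by simp
  next
    case middle
    have "gamma_beta \<beta> b = \<beta> - of_int a"
    proof (rule gamma_eqI)
      fix x assume x: "x \<in> nonper"
      \<comment> \<open>For x < \<beta> - a, neither \<beta> + x < S \<le> \<beta> nor I < x - 1 <
        \<beta> - a - 1 is possible.\<close>
      show "\<beta> - of_int a \<le> x"
        using lower[OF x] nonneg[OF x] middle by (auto split: if_splits)
    next
      show "\<beta> - of_int a \<le> 1" using beta_lt by simp
    next
      fix r :: real assume r: "\<beta> - of_int a < r" "r \<le> 1"
      obtain j where j: "2 * \<beta> - of_int a - 1 < one.Pval (j, -1)" using S_less middle by auto
      \<comment> \<open>The second term is the midpoint of \<beta> - a and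
        \<open>one.Pval (j, -1) - \<beta> + 1\<close>, the bound that r' must not reach.\<close>
      define r' where "r' = min r ((one.Pval (j, -1) + 1 - of_int a) / 2)"
      have "\<beta> - of_int 1 + r' < one.Pval (j, -1)" "\<beta> - of_int a < r'" "r' \<le> 1" "r' \<le> r"
        using r j by (auto simp: r'_def min_def field_simps)
      then show "\<exists>x\<in>nonper. x < r"
        using nonper_high[of 1 r' j "\<beta> - of_int a"] beta_gt by force
    qed
    then show ?thesis using middle by auto
  next
    case other
    have "gamma_beta \<beta> b = 1 + I"
    proof (rule gamma_eqI)
      fix x assume x: "x \<in> nonper"
      \<comment> \<open>A violated upper condition forces x \<ge> \<beta> - a, as S \<le> \<beta>,
        and then S > 2 \<beta> - a - 1. So I < \<beta> - a - 1 in this case, and 1 + I < x.\<close>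
      show "1 + I \<le> x"
        using lower[OF x] nonneg[OF x] other by (auto split: if_splits)
    next
      fix r :: real assume r: "1 + I < r" "r \<le> 1"
      then obtain j where j: "one.Pval (j, 0) < r - 1" using I_less[of "r - 1"] by auto
      have Ij: "I \<le> one.Pval (j, 0)"
        unfolding I_def by (rule cINF_lower[OF one.bdd_Pval(1)]) simp
      \<comment> \<open>The left end is the midpoint of 1 + \<open>one.Pval (j, 0)\<close> and r; it
        is nonnegative because I \<ge> -1.\<close>
      show "\<exists>x\<in>nonper. x < r"
        using nonper_low[of j "(1 + one.Pval (j, 0) + r) / 2" r] j r Ij other(1)
        by (auto simp: field_simps)
    qed (use I0 in auto)
    then show ?thesis using other by auto
  qed
  then show ?thesis unfolding Let_def S I .
qed

end
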